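(* Given any market for liquidity $(\mathcal{B}_t,\mathcal{L}_t,\mathbf{P})$ where the preferences are strict (lenders charge no risk premium and prefer safer borrowers), there exists a unique stable matching $\mu^*_t$ at time $t$. Moreover, the amount of liquidity exchanged at time $t$ is bounded as follows: $\mathrm{Vol}(\mu^*_t)\le\min(|\mathcal{B}_t|,|\mathcal{L}_t|)$.
   Context: **Market.** $\mathcal{N}$ is a finite set of banks; $\mathcal{L}_t,\mathcal{B}_t\subseteq\mathcal{N}$ are disjoint sets (potential lenders and potential borrowers); $\mathbf{P}$ is the collection of all preference lists described below. Each lender $i$ has a lending rate $r_i$, charged to any borrower (no risk premium). Each borrower $j$ has a reservation rate $\bar r_j$ and a default probability $\rho_j$ on a loan of maturity $S$ periods. **Preferences.** Borrower $j$ prefers an option with a lower rate, where the option "borrow from lender $i$" has rate $r_i$ and the option "stay unmatched" (denoted $j$) has rate $\bar r_j$. The expected payoff of lender $i$ from lending to borrower $j$ is $\frac{1}{(1+r_i)^S}(1-\rho_j)(1+r_i)^S-1$, so lender $i$ prefers borrowers with lower default probability. "Preferences are strict" means that there are no ties in these preference lists; in particular the $r_i$ are pairwise distinct and the $\rho_j$ are pairwise distinct. **Matching.** A matching $\mu_t$ is a one-to-one correspondence from $\mathcal{N}$ onto itself with $\mu_t(\mu_t(a))=a$ for all $a$, such that for any $b\in\mathcal{B}_t$, if $\mu_t(b)\neq b$ then $\mu_t(b)\in\mathcal{L}_t$, and for any $l\in\mathcal{L}_t$, if $\mu_t(l)\neq l$ then $\mu_t(l)\in\mathcal{B}_t$.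 A bank $a$ with $\mu_t(a)=a$ is unmatched. The volume is $\mathrm{Vol}(\mu_t)=\frac12\sum_{i\in\mathcal{L}_t\cup\mathcal{B}_t}\mathbf{1}\{\mu_t(i)\neq i\}$. **Stable matching.** A matching $\mu^*$ is stable if: (I) (pairwise deviation) for all $i,l\in\mathcal{L}_t$ and $k,j\in\mathcal{B}_t$ such that $\mu^*(i)=j$ and $\mu^*(k)=l$, it cannot be that both $i$ strictly prefers $k$ to $j$ and $k$ strictly prefers $i$ to $l$; (II) (coalitional deviation) let $\vec b\subseteq\mathcal{B}_t$ be a set of borrowers such that their assigned lenders are indifferent between any borrowers in $\vec b$ (for any $j,k\in\vec b$, lender $\mu^*(j)$ is indifferent between $j$ and $k$); then there cannot be another matching $\mu'$ such that every $j\in\vec b$ strictly prefers $\mu'(j)$ to $\mu^*(j)$ (this condition expresses that no group of borrowing banks can agree to swap counter-parties if their lenders are indifferent; it is regarded as not applying when lenders' preferences are strict); (III) (unilateral deviation) for any $j\in\mathcal{B}_t$ with $\mu^*(j)\neq j$, it cannot be that $j$ strictly prefers staying unmatched to $\mu^*(j)$; and for any $j\in\mathcal{B}_t$, it cannot be that $j$ strictly prefers to $\mu^*(j)$ some $k\in\mathcal{L}_t$ with $\mu^*(k)=k$.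
   Formalization: Uniqueness fails as stated (one lender, two willing borrowers), so in (I) the deviating borrower k may also be unmatched (l = k), and banks that are neither potential lenders nor potential borrowers are required to stay unmatched. *)

theory Defs
  imports Complex_Main "HOL-Combinatorics.Permutations"
begin

record 'a market =
  banks :: "'a set"
  lenders :: "'a set"
  borrowers :: "'a set"
  rate :: "'a \<Rightarrow> real"
  reservation :: "'a \<Rightarrow> real"
  default_prob :: "'a \<Rightarrow> real"
  maturity :: nat

text \<open>Rates of lenders exceed \<open>-1\<close>, so that the discount factor in \<open>lender_payoff\<close> below is
  meaningful; negative rates are not excluded.\<close>

definition liquidity_market :: "'a market \<Rightarrow> bool" where
  "liquidity_market M \<longleftrightarrow>
     finite (banks M) \<and> lenders M \<subseteq> banks M \<and> borrowers M \<subseteq> banks M \<and>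
     lenders M \<inter> borrowers M = {} \<and>
     (\<forall>i\<in>lenders M. - 1 < rate M i) \<and>
     (\<forall>j\<in>borrowers M. 0 \<le> default_prob M j \<and> default_prob M j \<le> 1)"

text \<open>The options of borrower \<open>j\<close> are the lenders and \<open>j\<close> itself, the latter standing for staying
  unmatched.\<close>

definition option_rate :: "'a market \<Rightarrow> 'a \<Rightarrow> 'a \<Rightarrow> real" where
  "option_rate M j x = (if x = j then reservation M j else rate M x)"

definition borrower_prefers :: "'a market \<Rightarrow> 'a \<Rightarrow> 'a \<Rightarrow> 'a \<Rightarrow> bool" where
  "borrower_prefers M j x y \<longleftrightarrow> option_rate M j x < option_rate M j y"

definition lender_payoff :: "'a market \<Rightarrow> 'a \<Rightarrow> 'a \<Rightarrow> real" where
  "lender_payoff M i j =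
     1 / (1 + rate M i) ^ maturity M * (1 - default_prob M j) * (1 + rate M i) ^ maturity M - 1"

definition lender_prefers :: "'a market \<Rightarrow> 'a \<Rightarrow> 'a \<Rightarrow> 'a \<Rightarrow> bool" where
  "lender_prefers M i j k \<longleftrightarrow> lender_payoff M i j > lender_payoff M i k"

definition lender_indifferent :: "'a market \<Rightarrow> 'a \<Rightarrow> 'a \<Rightarrow> 'a \<Rightarrow> bool" where
  "lender_indifferent M i j k \<longleftrightarrow> lender_payoff M i j = lender_payoff M i k"

text \<open>No ties: neither in the list of a borrower, which ranks the lenders and staying unmatched, nor
  in the list of a lender, which ranks the borrowers.\<close>

definition strict_preferences :: "'a market \<Rightarrow> bool" where
  "strict_preferences M \<longleftrightarrow>
     (\<forall>j\<in>borrowers M. inj_on (option_rate M j) (insert j (lenders M))) \<and>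
     (\<forall>i\<in>lenders M. inj_on (lender_payoff M i) (borrowers M))"

text \<open>The last clause is a convention: a bank that is neither a potential lender nor a potential
  borrower does not trade.  Without it, two such banks could be matched to each other, and no
  stable matching would be unique.  Likewise \<open>permutes\<close> fixes everything that is not a bank.\<close>

definition matching :: "'a market \<Rightarrow> ('a \<Rightarrow> 'a) \<Rightarrow> bool" where
  "matching M \<mu> \<longleftrightarrow>
     \<mu> permutes banks M \<and>
     (\<forall>a\<in>banks M. \<mu> (\<mu> a) = a) \<and>
     (\<forall>b\<in>borrowers M. \<mu> b \<noteq> b \<longrightarrow> \<mu> b \<in> lenders M) \<and>
     (\<forall>l\<in>lenders M. \<mu> l \<noteq> l \<longrightarrow> \<mu> l \<in> borrowers M) \<and>
     (\<forall>a\<in>banks M. \<mu> a \<noteq> a \<longrightarrow> a \<in> lenders M \<union> borrowers M)"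

definition volume :: "'a market \<Rightarrow> ('a \<Rightarrow> 'a) \<Rightarrow> real" where
  "volume M \<mu> = 1 / 2 * (\<Sum>i\<in>lenders M \<union> borrowers M. of_bool (\<mu> i \<noteq> i))"

text \<open>The deviating borrower \<open>k\<close> may be matched to a lender \<open>l\<close> or unmatched (\<open>l = k\<close>).  With
  \<open>l \<in> lenders M\<close> only, a matched lender and an unmatched borrower could never block, and a single
  lender facing two borrowers willing to borrow would admit two stable matchings.\<close>

definition pairwise_stable :: "'a market \<Rightarrow> ('a \<Rightarrow> 'a) \<Rightarrow> bool" where
  "pairwise_stable M \<mu> \<longleftrightarrow>
     (\<forall>i\<in>lenders M. \<forall>j\<in>borrowers M. \<forall>k\<in>borrowers M. \<forall>l\<in>insert k (lenders M).
        \<mu> i = j \<and> \<mu> k = l \<longrightarrow> \<not> (lender_prefers M i k j \<and> borrower_prefers M k i l))"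

text \<open>A deviating coalition consists of at least two borrowers, each with an assigned lender.
  Indifference of a lender between a borrower and itself does not count: for singletons the
  condition would require every matched borrower to get its most preferred lender.  With strict
  preferences there are no coalitions in this sense, so the condition holds vacuously.\<close>

definition coalitionally_stable :: "'a market \<Rightarrow> ('a \<Rightarrow> 'a) \<Rightarrow> bool" where
  "coalitionally_stable M \<mu> \<longleftrightarrow>
     (\<forall>bs \<subseteq> borrowers M.
        2 \<le> card bs \<and> (\<forall>j\<in>bs. \<mu> j \<in> lenders M) \<and>
        (\<forall>j\<in>bs. \<forall>k\<in>bs. lender_indifferent M (\<mu> j) j k) \<longrightarrow>
        \<not> (\<exists>\<mu>'. matching M \<mu>' \<and> (\<forall>j\<in>bs. borrower_prefers M j (\<mu>' j) (\<mu> j))))"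

definition unilaterally_stable :: "'a market \<Rightarrow> ('a \<Rightarrow> 'a) \<Rightarrow> bool" where
  "unilaterally_stable M \<mu> \<longleftrightarrow>
     (\<forall>j\<in>borrowers M. \<mu> j \<noteq> j \<longrightarrow> \<not> borrower_prefers M j j (\<mu> j)) \<and>
     (\<forall>j\<in>borrowers M. \<not> (\<exists>k\<in>lenders M. \<mu> k = k \<and> borrower_prefers M j k (\<mu> j)))"

definition stable_matching :: "'a market \<Rightarrow> ('a \<Rightarrow> 'a) \<Rightarrow> bool" where
  "stable_matching M \<mu> \<longleftrightarrow>
     matching M \<mu> \<and> pairwise_stable M \<mu> \<and> coalitionally_stable M \<mu> \<and> unilaterally_stable M \<mu>"

end

theory Submission
  imports Defs
begin

text \<open>A lender's payoff equals \<open>- \<rho>\<^sub>j\<close>, so all lenders rank the borrowers alike and stability amounts to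
  serial dictatorship: the borrowers, from the safest to the riskiest, each take the cheapest lender
  left, provided its rate is below their reservation rate.  Existence follows by adding the riskiest
  borrower last, uniqueness by considering the safest borrower on which two stable matchings
  disagree.\<close>

section \<open>Preference lists and basic properties of matchings\<close>

text \<open>Rates above \<open>- 1\<close> make the two powers nonzero, so they cancel and the
  lender drops out.\<close>

lemma lender_payoff_eq:
  assumes "liquidity_market M" "i \<in> lenders M"
  shows "lender_payoff M i j = - default_prob M j"
proof -
  have "(1 + rate M i) ^ maturity M \<noteq> 0"
    using assms by (auto simp: liquidity_market_def)
  then show ?thesis by (simp add: lender_payoff_def field_simps)
qed

text \<open>Strictness constrains default probabilities only through the list of some lender, hence
  the lender \<open>i\<close> among the hypotheses.\<close>

lemma inj_on_default_prob:
  assumes "liquidity_market M" "strict_preferences M" "i \<in> lenders M"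
  shows "inj_on (default_prob M) (borrowers M)"
  using assms by (auto simp: strict_preferences_def inj_on_def lender_payoff_eq)

lemma option_rate_lender:
  assumes "liquidity_market M" "j \<in> borrowers M" "i \<in> lenders M"
  shows "option_rate M j i = rate M i"
  using assms by (auto simp: liquidity_market_def option_rate_def)

lemma option_rate_self [simp]: "option_rate M j j = reservation M j"
  by (simp add: option_rate_def)

lemma matching_involution:
  assumes "matching M \<mu>"
  shows "\<mu> (\<mu> a) = a"
  using assms by (metis matching_def permutes_not_in)

lemma matching_borrower:
  assumes "matching M \<mu>" "b \<in> borrowers M"
  shows "\<mu> b \<in> insert b (lenders M)"
  using assms by (auto simp: matching_def)

lemma matching_lender:
  assumes "matching M \<mu>" "l \<in> lenders M"
  shows "\<mu> l \<in> insert l (borrowers M)"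
  using assms by (auto simp: matching_def)

lemma matching_outside:
  assumes "matching M \<mu>" "a \<notin> lenders M" "a \<notin> borrowers M"
  shows "\<mu> a = a"
  using assms by (metis UnE matching_def permutes_not_in)

section \<open>Stability under strict preferences\<close>

lemma coalitionally_stable_if_strict:
  assumes "strict_preferences M"
  shows "coalitionally_stable M \<mu>"
  unfolding coalitionally_stable_def
proof (intro allI impI, elim conjE)
  fix bs
  assume bs: "bs \<subseteq> borrowers M" "2 \<le> card bs" "\<forall>j\<in>bs. \<mu> j \<in> lenders M"
    "\<forall>j\<in>bs. \<forall>k\<in>bs. lender_indifferent M (\<mu> j) j k"
  \<comment> \<open>\<open>card\<close> of an infinite set is 0, so the bound 2 rules out that case
    too and yields two distinct members, which would tie in the list of the lender
    \<open>\<mu> j\<close>.\<close>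
  obtain j k where jk: "j \<in> bs" "k \<in> bs" "j \<noteq> k"
    using bs(2) card_le_Suc0_iff_eq[of bs] card.infinite[of bs] by fastforce
  have "lender_payoff M (\<mu> j) j = lender_payoff M (\<mu> j) k"
    using bs(4) jk unfolding lender_indifferent_def by blast
  moreover have "inj_on (lender_payoff M (\<mu> j)) (borrowers M)"
    using assms bs(3) jk(1) by (simp add: strict_preferences_def)
  ultimately have "j = k"
    using bs(1) jk by (meson inj_onD subsetD)
  with jk show "\<not> (\<exists>\<mu>'. matching M \<mu>' \<and> (\<forall>j\<in>bs. borrower_prefers M j (\<mu>' j) (\<mu> j)))"
    by simp
qed

text \<open>Coalitional stability is automatic here, and the other conditions merge: a lender
  cheaper than the current option of \<open>j\<close> must be matched (unilateral stability), and to
  a borrower at least as safe as \<open>j\<close> (pairwise stability). Existence and uniqueness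
  both rest on this form.\<close>

lemma stable_matching_iff:
  assumes M: "liquidity_market M" "strict_preferences M"
  shows "stable_matching M \<mu> \<longleftrightarrow>
    matching M \<mu> \<and>
    (\<forall>j\<in>borrowers M. option_rate M j (\<mu> j) \<le> reservation M j) \<and>
    (\<forall>j\<in>borrowers M. \<forall>i\<in>lenders M. rate M i < option_rate M j (\<mu> j) \<longrightarrow>
       \<mu> i \<noteq> i \<and> default_prob M (\<mu> i) \<le> default_prob M j)"
    (is "_ \<longleftrightarrow> _ \<and> ?R \<and> ?P")
proof (cases "matching M \<mu>")
  case matching: True
  have opt: "option_rate M j i = rate M i" if "j \<in> borrowers M" "i \<in> lenders M" for i j
    using option_rate_lender[OF M(1)] that .
  have pw: "pairwise_stable M \<mu> \<longleftrightarrow>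
      (\<forall>i\<in>lenders M. \<forall>j\<in>borrowers M. \<mu> i \<in> borrowers M \<longrightarrow>
         rate M i < option_rate M j (\<mu> j) \<longrightarrow> default_prob M (\<mu> i) \<le> default_prob M j)"
    (is "_ \<longleftrightarrow> ?P'")
  proof
    show ?P' if "pairwise_stable M \<mu>"
    proof (intro ballI impI)
      fix i j
      assume i: "i \<in> lenders M" "\<mu> i \<in> borrowers M" and j: "j \<in> borrowers M"
        and less: "rate M i < option_rate M j (\<mu> j)"
      \<comment> \<open>Here \<open>j\<close> is the deviating borrower and \<open>\<mu> i\<close>
        the deserted one; \<open>matching_borrower\<close> puts \<open>\<mu> j\<close> in the range
        that the definition allows for \<open>l\<close>.\<close>
      have "\<not> (lender_prefers M i j (\<mu> i) \<and> borrower_prefers M j i (\<mu> j))"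
        using that i j matching_borrower[OF matching j] unfolding pairwise_stable_def by blast
      then show "default_prob M (\<mu> i) \<le> default_prob M j"
        using less by (simp add: lender_prefers_def borrower_prefers_def
            lender_payoff_eq[OF M(1) i(1)] opt[OF j i(1)])
    qed
  next
    show "pairwise_stable M \<mu>" if ?P'
      unfolding pairwise_stable_def
    proof (intro ballI impI notI, elim conjE)
      fix i j k l
      assume i: "i \<in> lenders M" "\<mu> i = j" and j: "j \<in> borrowers M"
        and k: "k \<in> borrowers M" "\<mu> k = l"
        and prefers: "lender_prefers M i k j" "borrower_prefers M k i l"
      have "default_prob M k < default_prob M j" "rate M i < option_rate M k (\<mu> k)"
        using prefers i k by (simp_all add: lender_prefers_def borrower_prefers_def
            lender_payoff_eq[OF M(1) i(1)] opt)
      then show False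
        using that i j k by (metis linorder_not_le)
    qed
  qed
  have un: "unilaterally_stable M \<mu> \<longleftrightarrow> ?R \<and>
      (\<forall>j\<in>borrowers M. \<forall>i\<in>lenders M. rate M i < option_rate M j (\<mu> j) \<longrightarrow> \<mu> i \<noteq> i)"
  proof -
    \<comment> \<open>For unmatched \<open>j\<close> both sides hold, since its option rate is then
      the reservation rate itself.\<close>
    have "\<mu> j = j \<or> \<not> borrower_prefers M j j (\<mu> j) \<longleftrightarrow> option_rate M j (\<mu> j) \<le> reservation M j" for j
      by (cases "\<mu> j = j") (simp_all add: borrower_prefers_def not_less)
    moreover have "borrower_prefers M j i (\<mu> j) \<longleftrightarrow> rate M i < option_rate M j (\<mu> j)"
      if "j \<in> borrowers M" "i \<in> lenders M" for i j
      using that by (simp add: borrower_prefers_def opt)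
    ultimately show ?thesis
      unfolding unilaterally_stable_def by blast
  qed
  \<comment> \<open>This joins \<open>pw\<close> and \<open>un\<close>: what \<open>un\<close>
    provides as \<open>\<mu> i \<noteq> i\<close> is the premise
    \<open>\<mu> i \<in> borrowers M\<close> of \<open>pw\<close>.\<close>
  have fixed: "\<mu> i \<in> borrowers M \<longleftrightarrow> \<mu> i \<noteq> i" if "i \<in> lenders M" for i
    using that matching_lender[OF matching that] M(1) by (auto simp: liquidity_market_def)
  show ?thesis
    using matching coalitionally_stable_if_strict[OF M(2)] fixed
    by (auto simp: stable_matching_def pw un)
qed (simp add: stable_matching_def)

section \<open>Existence, by induction on the number of borrowers\<close>

text \<open>The riskiest borrower \<open>b\<close> comes last in the list of every lender, so it
  displaces nobody and only chooses among the lenders that a stable matching of the smaller market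
  leaves unmatched. The conditions on the other borrowers survive this.\<close>

lemma ex_stable_matching:
  assumes "liquidity_market M" "strict_preferences M"
  shows "\<exists>\<mu>. stable_matching M \<mu>"
  using assms
proof (induction "card (borrowers M)" arbitrary: M)
  case 0
  then have "borrowers M = {}"
    by (metis card_0_eq finite_subset liquidity_market_def)
  then have "stable_matching M id"
    using 0 by (simp add: stable_matching_iff matching_def permutes_id)
  then show ?case by blast
next
  case (Suc n)
  note M = Suc.prems
  have fin: "finite (borrowers M)" "finite (lenders M)"
    and subset: "lenders M \<subseteq> banks M" "borrowers M \<subseteq> banks M"
    and disj: "lenders M \<inter> borrowers M = {}"
    using M(1) by (auto simp: liquidity_market_def intro: finite_subset)
  have ne: "borrowers M \<noteq> {}"
    using Suc.hyps(2) by auto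
  obtain b where b: "b \<in> borrowers M"
    and b_max: "\<And>j. j \<in> borrowers M \<Longrightarrow> default_prob M j \<le> default_prob M b"
    using arg_min_if_finite(1)[OF fin(1) ne, of "\<lambda>j. - default_prob M j"]
      arg_min_least[OF fin(1) ne, of _ "\<lambda>j. - default_prob M j"] by auto
  define M' where "M' = M\<lparr>borrowers := borrowers M - {b}\<rparr>"
  have sel [simp]: "banks M' = banks M" "lenders M' = lenders M" "rate M' = rate M"
    "reservation M' = reservation M" "default_prob M' = default_prob M"
    "borrowers M' = borrowers M - {b}" "option_rate M' = option_rate M"
    "lender_payoff M' = lender_payoff M"
    by (simp_all add: M'_def option_rate_def lender_payoff_def fun_eq_iff)
  have M': "liquidity_market M'" "strict_preferences M'"
    using M by (auto simp: liquidity_market_def strict_preferences_def intro: inj_on_subset)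
  have "n = card (borrowers M')"
    using Suc.hyps(2) b fin by simp
  then obtain \<mu> where st: "stable_matching M' \<mu>"
    using Suc.hyps(1) M' by blast
  then have \<mu>: "matching M' \<mu>"
    and rat: "\<And>j. j \<in> borrowers M - {b} \<Longrightarrow> option_rate M j (\<mu> j) \<le> reservation M j"
    and pair: "\<And>j i. j \<in> borrowers M - {b} \<Longrightarrow> i \<in> lenders M \<Longrightarrow>
       rate M i < option_rate M j (\<mu> j) \<Longrightarrow> \<mu> i \<noteq> i \<and> default_prob M (\<mu> i) \<le> default_prob M j"
    unfolding stable_matching_iff[OF M'] sel by blast+
  \<comment> \<open>In \<open>M'\<close> the bank \<open>b\<close> is neither lender nor borrower,
    so the convention on outsiders in \<open>matching\<close> leaves it unmatched.\<close>
  have \<mu>b: "\<mu> b = b"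
    using matching_outside[OF \<mu>] b disj by auto
  have lender: "\<mu> i \<in> borrowers M" if "i \<in> lenders M" "\<mu> i \<noteq> i" for i
    using matching_lender[OF \<mu>] that by auto
  \<comment> \<open>The lenders that are still free and acceptable to \<open>b\<close>.\<close>
  define U where "U = {l \<in> lenders M. \<mu> l = l \<and> rate M l < reservation M b}"
  have "finite U"
    using fin by (simp add: U_def)
  show ?case
  proof (cases "U = {}")
    case True
    have "matching M \<mu>"
      using \<mu> \<mu>b by (auto simp: matching_def)
    moreover have "option_rate M j (\<mu> j) \<le> reservation M j" if "j \<in> borrowers M" for j
      using rat[of j] that \<mu>b by (cases "j = b") auto
    moreover have "\<mu> i \<noteq> i \<and> default_prob M (\<mu> i) \<le> default_prob M j"
      if "j \<in> borrowers M" "i \<in> lenders M" "rate M i < option_rate M j (\<mu> j)" for i j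
    proof (cases "j = b")
      case j: True
      \<comment> \<open>An unmatched \<open>i\<close> would belong to the empty set
        \<open>U\<close>.\<close>
      then have "\<mu> i \<noteq> i" using that True \<mu>b by (auto simp: U_def)
      then show ?thesis using b_max lender that j by auto
    qed (use pair that in auto)
    ultimately have "stable_matching M \<mu>"
      unfolding stable_matching_iff[OF M] by blast
    then show ?thesis by blast
  next
    case False
    obtain l where l: "l \<in> U" and l_min: "\<And>i. i \<in> U \<Longrightarrow> rate M l \<le> rate M i"
      using arg_min_if_finite(1)[OF \<open>finite U\<close> False, of "rate M"]
        arg_min_least[OF \<open>finite U\<close> False, of _ "rate M"] by auto
    have lL: "l \<in> lenders M" and \<mu>l: "\<mu> l = l" and lr: "rate M l < reservation M b"
      using l by (auto simp: U_def)
    have "l \<noteq> b" using lL b disj by auto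
    define \<nu> where "\<nu> = \<mu>(b := l, l := b)"
    have \<nu>b: "\<nu> b = l" and \<nu>l: "\<nu> l = b" and \<nu>o: "\<And>x. x \<noteq> b \<Longrightarrow> x \<noteq> l \<Longrightarrow> \<nu> x = \<mu> x"
      using \<open>l \<noteq> b\<close> by (auto simp: \<nu>_def)
    have \<nu>_eq: "\<nu> j = \<mu> j" if "j \<in> borrowers M" "j \<noteq> b" for j
      using that lL disj \<nu>o by blast
    \<comment> \<open>Both \<open>b\<close> and \<open>l\<close> are fixed points of
      \<open>\<mu>\<close>, so the update is a composition with a transposition and hence a
      permutation.\<close>
    have "\<nu> = \<mu> \<circ> transpose b l"
      using \<mu>b \<mu>l by (auto simp: \<nu>_def fun_eq_iff transpose_def)
    then have "\<nu> permutes banks M"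
      using \<mu> b lL subset by (auto simp: matching_def intro!: permutes_compose permutes_swap_id)
    moreover have "\<nu> (\<nu> a) = a" for a
      using \<nu>b \<nu>l \<nu>o \<mu>b \<mu>l matching_involution[OF \<mu>] by metis
    moreover have "\<nu> j \<in> lenders M" if "j \<in> borrowers M" "\<nu> j \<noteq> j" for j
      using matching_borrower[OF \<mu>, of j] that \<nu>b \<nu>_eq[of j] lL by (cases "j = b") auto
    moreover have "\<nu> i \<in> borrowers M" if "i \<in> lenders M" "\<nu> i \<noteq> i" for i
      using lender[of i] that \<nu>l \<nu>o[of i] b disj by (cases "i = l"; cases "i = b") auto
    moreover have "a \<in> lenders M \<union> borrowers M" if "\<nu> a \<noteq> a" for a
      using matching_outside[OF \<mu>, of a] that \<nu>o[of a] lL b by (cases "a = b"; cases "a = l") auto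
    ultimately have "matching M \<nu>"
      by (simp add: matching_def)
    moreover have opt_b: "option_rate M b (\<nu> b) = rate M l"
      using \<nu>b option_rate_lender[OF M(1) b lL] by simp
    moreover have "option_rate M j (\<nu> j) \<le> reservation M j" if "j \<in> borrowers M" for j
      using rat[of j] that \<nu>_eq opt_b lr by (cases "j = b") auto
    moreover have "\<nu> i \<noteq> i \<and> default_prob M (\<nu> i) \<le> default_prob M j"
      if j: "j \<in> borrowers M" and i: "i \<in> lenders M" and less: "rate M i < option_rate M j (\<nu> j)"
      for i j
    proof (cases "j = b")
      case True
      then have "rate M i < rate M l" using less opt_b by simp
      then have "i \<noteq> l" "i \<notin> U" using l_min by force+
      \<comment> \<open>Being cheaper than \<open>l\<close>, the lender \<open>i\<close> is
        acceptable to \<open>b\<close>, so only being matched can keep it out of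
        \<open>U\<close>.\<close>
      then have "\<mu> i \<noteq> i" using \<open>rate M i < rate M l\<close> lr i by (auto simp: U_def)
      moreover have "i \<noteq> b" using i b disj by auto
      ultimately show ?thesis using \<nu>o \<open>i \<noteq> l\<close> b_max lender i True by auto
    next
      case False
      \<comment> \<open>The option of \<open>j\<close> is the same as before, so stability of
        \<open>\<mu>\<close> applies; it shows \<open>i\<close> to be matched by
        \<open>\<mu>\<close>, hence different from \<open>l\<close>, which was free.\<close>
      then have *: "\<mu> i \<noteq> i \<and> default_prob M (\<mu> i) \<le> default_prob M j"
        using pair[of j i] i j less \<nu>_eq by auto
      then have "i \<noteq> l" "i \<noteq> b" using \<mu>l \<mu>b by auto
      then show ?thesis using * \<nu>o by simp
    qed
    ultimately have "stable_matching M \<nu>"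
      unfolding stable_matching_iff[OF M] by blast
    then show ?thesis by blast
  qed
qed

section \<open>Uniqueness\<close>

text \<open>The borrowers carry all the information: a matched lender is determined by the borrower
  sent to it, and every other bank outside \<open>borrowers M\<close> is unmatched.\<close>

lemma matching_eqI:
  assumes \<mu>: "matching M \<mu>" and \<nu>: "matching M \<nu>"
    and eq: "\<And>j. j \<in> borrowers M \<Longrightarrow> \<mu> j = \<nu> j"
  shows "\<mu> = \<nu>"
proof
  fix a
  consider "a \<in> borrowers M" | "a \<in> lenders M" | "a \<notin> lenders M" "a \<notin> borrowers M"
    by blast
  then show "\<mu> a = \<nu> a"
  proof cases
    case 2
    \<comment> \<open>If \<open>\<mu>\<close> sends \<open>a\<close> to a borrower,
      \<open>\<nu>\<close> agrees there and returns that borrower to \<open>a\<close>; likewise with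
      the roles exchanged.\<close>
    have "\<mu> a = a \<or> \<nu> (\<mu> a) = a" "\<nu> a = a \<or> \<mu> (\<nu> a) = a"
      using matching_lender[OF \<mu> 2] matching_lender[OF \<nu> 2] eq
        matching_involution[OF \<mu>] matching_involution[OF \<nu>] by (metis insertE)+
    then show ?thesis
      using matching_involution[OF \<mu>] matching_involution[OF \<nu>] by metis
  qed (use eq matching_outside \<mu> \<nu> in \<open>metis+\<close>)
qed

text \<open>If \<open>\<mu>\<close> gave \<open>j\<close> a strictly cheaper option, this would be a
  lender held under \<open>\<nu>\<close> by a strictly safer borrower; agreement on that borrower
  would make \<open>\<mu>\<close> assign one lender to two borrowers.\<close>

lemma stable_matching_first_disagreement:
  assumes M: "liquidity_market M" "strict_preferences M"
    and "stable_matching M \<mu>" "stable_matching M \<nu>"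
    and j: "j \<in> borrowers M"
    and agree: "\<And>k. k \<in> borrowers M \<Longrightarrow> default_prob M k < default_prob M j \<Longrightarrow> \<mu> k = \<nu> k"
  shows "option_rate M j (\<nu> j) \<le> option_rate M j (\<mu> j)"
proof (rule ccontr)
  assume "\<not> ?thesis"
  then have less: "option_rate M j (\<mu> j) < option_rate M j (\<nu> j)" by simp
  note \<mu> = assms(3)[unfolded stable_matching_iff[OF M]]
  note \<nu> = assms(4)[unfolded stable_matching_iff[OF M]]
  have "option_rate M j (\<nu> j) \<le> reservation M j"
    using \<nu> j by blast
  \<comment> \<open>Staying unmatched cannot yield a rate strictly below the reservation
    rate.\<close>
  then have "\<mu> j \<noteq> j" using less by auto
  then have i: "\<mu> j \<in> lenders M"
    using matching_borrower[of M \<mu> j] \<mu> j by auto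
  \<comment> \<open>The holder under \<open>\<nu>\<close> of the lender that \<open>\<mu>\<close>
    gives to \<open>j\<close>.\<close>
  let ?k = "\<nu> (\<mu> j)"
  have "rate M (\<mu> j) < option_rate M j (\<nu> j)"
    using less option_rate_lender[OF M(1) j i] by simp
  then have k: "?k \<noteq> \<mu> j" "default_prob M ?k \<le> default_prob M j"
    using \<nu> i j by auto
  have kB: "?k \<in> borrowers M"
    using matching_lender[of M \<nu> "\<mu> j"] \<nu> i k by auto
  have \<nu>k: "\<nu> ?k = \<mu> j"
    using \<nu> by (blast intro: matching_involution)
  then have "?k \<noteq> j" using less by auto
  \<comment> \<open>Distinct default probabilities sharpen the weak inequality from stability to the
    strict one that \<open>agree\<close> requires.\<close>
  then have "default_prob M ?k < default_prob M j"
    using inj_on_default_prob[OF M i] k kB j by (force simp: inj_on_def)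
  then have "\<mu> ?k = \<mu> j"
    using agree kB \<nu>k by simp
  then have "?k = j"
    using matching_involution[of M \<mu>] \<mu> by metis
  with \<open>?k \<noteq> j\<close> show False ..
qed

text \<open>At a safest borrower where the matchings differ, the comparison in both directions gives
  equal option rates, and the absence of ties then identifies the two options.\<close>

lemma stable_matching_unique:
  assumes M: "liquidity_market M" "strict_preferences M"
    and \<mu>: "stable_matching M \<mu>" and \<nu>: "stable_matching M \<nu>"
  shows "\<mu> = \<nu>"
proof (rule matching_eqI)
  show m: "matching M \<mu>" "matching M \<nu>"
    using \<mu> \<nu> by (simp_all add: stable_matching_def)
  define D where "D = {j \<in> borrowers M. \<mu> j \<noteq> \<nu> j}"
  have "D = {}"
  proof (rule ccontr)
    assume ne: "D \<noteq> {}"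
    have fin: "finite D"
      using M(1) by (auto simp: D_def liquidity_market_def intro: finite_subset)
    obtain j where j: "j \<in> D" and min: "\<And>k. k \<in> D \<Longrightarrow> default_prob M j \<le> default_prob M k"
      using arg_min_if_finite(1)[OF fin ne, of "default_prob M"]
        arg_min_least[OF fin ne, of _ "default_prob M"] by auto
    have jB: "j \<in> borrowers M" using j by (simp add: D_def)
    have agree: "\<mu> k = \<nu> k" if "k \<in> borrowers M" "default_prob M k < default_prob M j" for k
      using min[of k] that by (force simp: D_def)
    have "option_rate M j (\<mu> j) = option_rate M j (\<nu> j)"
      using stable_matching_first_disagreement[OF M \<mu> \<nu> jB]
        stable_matching_first_disagreement[OF M \<nu> \<mu> jB] agree by (metis order_antisym)
    moreover have "inj_on (option_rate M j) (insert j (lenders M))"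
      using M(2) jB by (simp add: strict_preferences_def)
    ultimately have "\<mu> j = \<nu> j"
      using matching_borrower[OF m(1) jB] matching_borrower[OF m(2) jB] by (metis inj_onD)
    then show False using j by (simp add: D_def)
  qed
  then show "\<mu> j = \<nu> j" if "j \<in> borrowers M" for j
    using that by (auto simp: D_def)
qed

section \<open>The bound on the volume\<close>

text \<open>As an involution, \<open>\<mu>\<close> pairs matched lenders with matched borrowers. The
  sum counts each pair twice, so the factor \<open>1 / 2\<close> leaves the common cardinality of
  the two sets.\<close>

lemma volume_le:
  assumes M: "liquidity_market M" and \<mu>: "matching M \<mu>"
  shows "volume M \<mu> \<le> real (min (card (borrowers M)) (card (lenders M)))"
proof -
  have fin: "finite (borrowers M)" "finite (lenders M)"
    and disj: "lenders M \<inter> borrowers M = {}"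
    using M by (auto simp: liquidity_market_def intro: finite_subset)
  let ?L = "{l \<in> lenders M. \<mu> l \<noteq> l}" and ?B = "{b \<in> borrowers M. \<mu> b \<noteq> b}"
  have "bij_betw \<mu> ?L ?B"
    by (rule bij_betw_byWitness[where f' = \<mu>])
      (use \<mu> matching_involution[OF \<mu>] in \<open>auto simp: matching_def\<close>)
  then have "card ?L = card ?B"
    by (rule bij_betw_same_card)
  moreover have "(\<Sum>i\<in>lenders M \<union> borrowers M. of_bool (\<mu> i \<noteq> i)) = real (card ?L) + real (card ?B)"
    unfolding sum.union_disjoint[OF fin(2,1) disj] using fin by (simp add: Int_def)
  moreover have "card ?L \<le> card (lenders M)" "card ?B \<le> card (borrowers M)"
    using fin by (auto intro: card_mono)
  ultimately show ?thesis
    by (simp add: volume_def)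
qed

theorem proposition4:
  fixes M :: "'a market"
  assumes "liquidity_market M"
    and "strict_preferences M"
  shows "(\<exists>!\<mu>. stable_matching M \<mu>) \<and>
    (\<forall>\<mu>. stable_matching M \<mu> \<longrightarrow>
       volume M \<mu> \<le> real (min (card (borrowers M)) (card (lenders M))))"
  using ex_stable_matching[OF assms] stable_matching_unique[OF assms] volume_le[OF assms(1)]
  by (auto simp: stable_matching_def[of M])

end
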